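(* Assume the following about the function $F:\mathbb{R}^n\times\Xi\to\mathbb{R}$: (a) $F$ is continuous; (b) for every $\xi\in\Xi$, $x\mapsto F(x,\xi)$ is convex on $X$; (c) for every $x\in X$, $\xi\mapsto F(x,\xi)$ is bounded on $\Xi$; (d) there exists $L>0$ such that $|F(x,\xi)-F(x,\xi')|\le L\,\|\xi-\xi'\|$ for all $\xi,\xi'\in\Xi$ and all $x\in X$. Let $\{\beta_N\}_{N\in\mathbb{N}}\subset(0,1)$ and $\{\epsilon_N\}_{N\in\mathbb{N}}\subset(0,\infty)$ be sequences such that $\sum_{N=1}^\infty\beta_N<\infty$, $\lim_{N\to\infty}\epsilon_N=0$, and $\mathbb{P}^N\big(W_1(\mathbb{P},\widehat{\mathbb{P}}_N)\le\epsilon_N\big)\ge 1-\beta_N$ for each $N\in\mathbb{N}$. Consider the risk-constrained program (RCP) $$\min_{x\in X}\ c^\intercal x\quad\text{s.t.}\quad \mathrm{CVaR}^{\mathbb{P}}_\alpha(F(x,\xi))\le 0,$$ and, for each $N$, the distributionally robust risk-constrained program (DRRCP$_N$) $$\min_{x\in X}\ c^\intercal x\quad\text{s.t.}\quad \sup_{\mathbb{Q}\in\mathcal{M}_N^{\epsilon_N}}\ \inf_{t\in\mathbb{R}}\ \mathbb{E}_{\mathbb{Q}}\big[(F(x,\xi)+t)_+-t\alpha\big]\le 0.$$ Let $\mathsf{J}^{\mathtt{RCP}}$ be the optimal value of RCP, and let $\mathsf{J}^{\mathtt{DRRCP}}_N$ and $x^{\mathtt{DRRCP}}_N$ be the optimal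 value and an optimizer of DRRCP$_N$, respectively. Assume that the feasibility set of RCP has a nonempty interior and that the optimizers of RCP belong to a compact set $\mathcal{Y}\subset X$. Moreover, assume that for sufficiently large $N$ and any sequence of i.i.d. samples $\{\widehat{\xi}_i\}_{i=1}^N$, the optimizers of DRRCP$_N$ belong to $\mathcal{Y}$. Then the following statements hold $\mathbb{P}^\infty$-almost surely: (i) $\mathsf{J}^{\mathtt{RCP}}\le\mathsf{J}^{\mathtt{DRRCP}}_N$ for all sufficiently large $N$; (ii) $\mathsf{J}^{\mathtt{DRRCP}}_N\to\mathsf{J}^{\mathtt{RCP}}$ as $N\to\infty$; (iii) any accumulation point of any sequence of optimizers $\{x^{\mathtt{DRRCP}}_N\}_{N\in\mathbb{N}}$ is an optimal solution of RCP.
   Context: Setting: $\Xi\subseteq\mathbb{R}^m$, $d$ is a complete metric on $\Xi$, and $\|\cdot\|$ is the norm on $\mathbb{R}^m$. $X\subseteq\mathbb{R}^n$ is a closed convex set, $c\in\mathbb{R}^n$, $\alpha\in(0,1)$. $\mathcal{P}_1(\Xi)$ is the set of Borel probability measures on $\Xi$ with finite first moment, and $\mathbb{P}\in\mathcal{P}_1(\Xi)$ is the distribution of the uncertain parameter $\xi$. Write $z_+=\max(z,0)$. CVaR: for a real-valued random variable $Y$ whose distribution is determined by $\mathbb{P}$, $\mathrm{CVaR}^{\mathbb{P}}_\alpha(Y):=\inf_{t\in\mathbb{R}}\{\alpha^{-1}\mathbb{E}_{\mathbb{P}}[(Y+t)_+]-t\}$. Wasserstein distance: for $\mu,\nu\in\mathcal{P}_1(\Xi)$,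 $W_1(\mu,\nu):=\min_{\gamma\in\mathcal{H}(\mu,\nu)}\int_{\Xi\times\Xi}d(\xi,\omega)\,\gamma(d\xi,d\omega)$, where $\mathcal{H}(\mu,\nu)$ is the set of probability measures on $\Xi\times\Xi$ with marginals $\mu$ and $\nu$. Samples and ambiguity sets: $\widehat{\xi}_1,\widehat{\xi}_2,\dots$ are drawn independently from $\mathbb{P}$; $\mathbb{P}^N$ and $\mathbb{P}^\infty$ are the $N$-fold and infinite product measures governing the samples. $\widehat{\mathbb{P}}_N:=\frac1N\sum_{i=1}^N\delta_{\widehat{\xi}_i}$ is the empirical distribution ($\delta_{\widehat\xi_i}$ is the unit point mass at $\widehat\xi_i$), and for $\theta\ge0$, $\mathcal{M}_N^\theta:=\{\mu\in\mathcal{P}_1(\Xi)\mid W_1(\mu,\widehat{\mathbb{P}}_N)\le\theta\}$. Thus DRRCP$_N$ is a random optimization problem.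
   Formalization: Two assumptions are added, since the claim can fail without them: some x in X has CVaR of F(x,ξ) strictly below 0 (a nonempty interior of the RCP feasibility set is not enough), and the metric d induces the usual topology of Ξ as a subset of R^m. *)

theory Defs
  imports "HOL-Probability.Probability"
begin

abbreviation borel_on :: "'a::topological_space set \<Rightarrow> 'a measure" where
  "borel_on \<Xi> \<equiv> restrict_space borel \<Xi>"

definition P1 :: "'a::topological_space set \<Rightarrow> ('a \<Rightarrow> 'a \<Rightarrow> real) \<Rightarrow> 'a measure set" where
  "P1 \<Xi> d = {\<mu>. prob_space \<mu> \<and> sets \<mu> = sets (borel_on \<Xi>) \<and> (\<exists>\<xi>\<^sub>0\<in>\<Xi>. integrable \<mu> (d \<xi>\<^sub>0))}"

definition couplings :: "'a measure \<Rightarrow> 'a measure \<Rightarrow> ('a \<times> 'a) measure set" where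
  "couplings \<mu> \<nu> = {\<gamma>. prob_space \<gamma> \<and> sets \<gamma> = sets (\<mu> \<Otimes>\<^sub>M \<nu>) \<and>
     distr \<gamma> \<mu> fst = \<mu> \<and> distr \<gamma> \<nu> snd = \<nu>}"

(* The minimum over couplings is written as an infimum: the value is the same, and attainment
   is not part of the definition. *)
definition W1 :: "('a \<Rightarrow> 'a \<Rightarrow> real) \<Rightarrow> 'a measure \<Rightarrow> 'a measure \<Rightarrow> ennreal" where
  "W1 d \<mu> \<nu> = (INF \<gamma>\<in>couplings \<mu> \<nu>. \<integral>\<^sup>+ z. ennreal (d (fst z) (snd z)) \<partial>\<gamma>)"

(* Samples are numbered from 0: the first N samples are s 0, ..., s (N - 1).
   Meaningful for N > 0 only. *)
definition empirical :: "'a::topological_space set \<Rightarrow> nat \<Rightarrow> (nat \<Rightarrow> 'a) \<Rightarrow> 'a measure" where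
  "empirical \<Xi> N s = measure_of \<Xi> (sets (borel_on \<Xi>))
     (\<lambda>A. ennreal (1 / real N) * (\<Sum>i<N. emeasure (return (borel_on \<Xi>) (s i)) A))"

lemma space_empirical [simp]: "space (empirical \<Xi> N s) = \<Xi>"
  using sets.space_closed[of "borel_on \<Xi>"]
  by (simp add: empirical_def space_measure_of space_restrict_space)

lemma sets_empirical [simp]: "sets (empirical \<Xi> N s) = sets (borel_on \<Xi>)"
  using sets.sets_measure_of_eq[of "borel_on \<Xi>"]
  by (simp add: empirical_def space_restrict_space sets_measure_of_conv)

lemma emeasure_empirical:
  assumes "A \<in> sets (borel_on \<Xi>)"
  shows "emeasure (empirical \<Xi> N s) A =
    ennreal (1 / real N) * (\<Sum>i<N. emeasure (return (borel_on \<Xi>) (s i)) A)"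
proof -
  let ?f = "\<lambda>A. ennreal (1 / real N) * (\<Sum>i<N. emeasure (return (borel_on \<Xi>) (s i)) A)"
  have "countably_additive (sets (borel_on \<Xi>)) ?f"
  proof (rule countably_additiveI)
    fix B :: "nat \<Rightarrow> 'a set"
    assume B: "range B \<subseteq> sets (borel_on \<Xi>)" "disjoint_family B"
    have "(\<Sum>k. emeasure (return (borel_on \<Xi>) (s i)) (B k)) =
        emeasure (return (borel_on \<Xi>) (s i)) (\<Union>k. B k)" for i
      using B by (intro suminf_emeasure) auto
    then show "(\<Sum>k. ?f (B k)) = ?f (\<Union>k. B k)"
      by (simp add: suminf_sum[OF summableI])
  qed
  then show ?thesis
    using assms
    by (intro emeasure_measure_of[OF empirical_def])
      (auto simp: positive_def sets_restrict_space)
qed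

definition ambiguity_set ::
  "'a::topological_space set \<Rightarrow> ('a \<Rightarrow> 'a \<Rightarrow> real) \<Rightarrow> real \<Rightarrow> nat \<Rightarrow> (nat \<Rightarrow> 'a) \<Rightarrow> 'a measure set" where
  "ambiguity_set \<Xi> d \<theta> N s = {\<mu>\<in>P1 \<Xi> d. W1 d \<mu> (empirical \<Xi> N s) \<le> ennreal \<theta>}"

(* Infima and suprema are taken in ereal, so that no boundedness or nonemptiness side condition
   is hidden in them. The expectations are Bochner integrals, so Y has to be integrable. *)
definition CVaR :: "'a measure \<Rightarrow> real \<Rightarrow> ('a \<Rightarrow> real) \<Rightarrow> ereal" where
  "CVaR P \<alpha> Y = (INF t::real. ereal (inverse \<alpha> * (\<integral>\<xi>. max (Y \<xi> + t) 0 \<partial>P) - t))"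

definition worst_case_risk :: "'a measure set \<Rightarrow> real \<Rightarrow> ('a \<Rightarrow> real) \<Rightarrow> ereal" where
  "worst_case_risk \<M> \<alpha> Y =
    (SUP Q\<in>\<M>. INF t::real. ereal (\<integral>\<xi>. (max (Y \<xi> + t) 0 - t * \<alpha>) \<partial>Q))"

(* A nonempty topological interior of this set does not yield a point with CVaR < 0 (take
   F x \<xi> = max (\<bar>x\<bar> - 1) 0), and consistency of the robust programs can then fail; hence the theorem also
   assumes such a strictly feasible point. *)
definition rcp_feasible ::
  "'x set \<Rightarrow> 'a measure \<Rightarrow> real \<Rightarrow> ('x \<Rightarrow> 'a \<Rightarrow> real) \<Rightarrow> 'x set" where
  "rcp_feasible X P \<alpha> F = {x\<in>X. CVaR P \<alpha> (F x) \<le> 0}"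

definition drrcp_feasible ::
  "'x set \<Rightarrow> 'a measure set \<Rightarrow> real \<Rightarrow> ('x \<Rightarrow> 'a \<Rightarrow> real) \<Rightarrow> 'x set" where
  "drrcp_feasible X \<M> \<alpha> F = {x\<in>X. worst_case_risk \<M> \<alpha> (F x) \<le> 0}"

(* The value is \<infinity> for an infeasible program and -\<infinity> for an unbounded one. *)
definition optimal_value :: "'x::real_inner \<Rightarrow> 'x set \<Rightarrow> ereal" where
  "optimal_value c S = (INF x\<in>S. ereal (c \<bullet> x))"

definition optimizers :: "'x::real_inner \<Rightarrow> 'x set \<Rightarrow> 'x set" where
  "optimizers c S = {x\<in>S. \<forall>y\<in>S. c \<bullet> x \<le> c \<bullet> y}"

definition accumulation_point :: "(nat \<Rightarrow> 'x::topological_space) \<Rightarrow> 'x \<Rightarrow> bool" where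
  "accumulation_point x z \<longleftrightarrow> (\<exists>r::nat \<Rightarrow> nat. strict_mono r \<and> (x \<circ> r) \<longlonglongrightarrow> z)"

end

(* Almost surely P itself lies in the ambiguity set for all large N (Borel-Cantelli), so eventually
   every robustly feasible point is feasible; this is (i). Conversely, a feasible point can be moved
   slightly towards a strictly feasible one, which makes its CVaR negative by convexity. For a fixed
   bounded continuous g, the suprema of the Q-integrals of g over the shrinking balls converge to
   the P-integral: dominate g by its d-Lipschitz upper envelopes, on which W1 controls integrals, and
   let the envelopes decrease to g. So strictly feasible points are eventually robustly feasible,
   and (ii) follows. For (iii) the feasible set is closed, by Fatou's lemma applied along a convergent
   sequence of near-optimal t; such t cannot escape to infinity because \<alpha> < 1.

   The metric d need not be comparable with the norm, so Lipschitz continuity of F in the norm gives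
   no rate in W1; the envelopes replace it. *)

theory Submission
  imports Defs
begin

section \<open>Wasserstein distance and integrals of Lipschitz functions\<close>

text \<open>The easy half of Kantorovich duality: a coupling brings both integrals to the product
  space, where the Lipschitz condition bounds the integrand by the transport cost. Boundedness of
  \<open>h\<close> makes it integrable there.\<close>

lemma integral_diff_le_W1:
  fixes h :: "'a \<Rightarrow> real"
  assumes [measurable]: "h \<in> borel_measurable \<mu>" "h \<in> borel_measurable \<nu>"
    and bound: "\<And>x. x \<in> space \<mu> \<union> space \<nu> \<Longrightarrow> \<bar>h x\<bar> \<le> B"
    and Lipschitz: "\<And>x y. x \<in> space \<mu> \<Longrightarrow> y \<in> space \<nu> \<Longrightarrow> \<bar>h x - h y\<bar> \<le> k * d x y"
    and "0 < k" "0 \<le> \<theta>" and W1: "W1 d \<mu> \<nu> \<le> ennreal \<theta>"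
  shows "\<bar>(\<integral>x. h x \<partial>\<mu>) - (\<integral>x. h x \<partial>\<nu>)\<bar> \<le> k * \<theta>"
proof (rule field_le_epsilon)
  fix e :: real assume "0 < e"
  \<comment> \<open>\<open>W1\<close> is an infimum, so a coupling of cost below
    \<open>\<theta> + e / k\<close> is chosen; the factor \<open>k\<close> turns the excess into
    \<open>e\<close>.\<close>
  then have "W1 d \<mu> \<nu> < ennreal (\<theta> + e / k)"
    using W1 \<open>0 < k\<close> \<open>0 \<le> \<theta>\<close> by (auto intro!: le_less_trans[OF W1] simp: ennreal_less_iff)
  then obtain \<gamma> where \<gamma>: "\<gamma> \<in> couplings \<mu> \<nu>"
    and cost: "(\<integral>\<^sup>+ z. ennreal (d (fst z) (snd z)) \<partial>\<gamma>) < ennreal (\<theta> + e / k)"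
    unfolding W1_def INF_less_iff by blast
  interpret \<gamma>: prob_space \<gamma> using \<gamma> by (simp add: couplings_def)
  have [measurable_cong]: "sets \<gamma> = sets (\<mu> \<Otimes>\<^sub>M \<nu>)" using \<gamma> by (simp add: couplings_def)
  have space: "space \<gamma> = space \<mu> \<times> space \<nu>"
    using sets_eq_imp_space_eq[OF \<open>sets \<gamma> = sets (\<mu> \<Otimes>\<^sub>M \<nu>)\<close>] by (simp add: space_pair_measure)
  have int: "integrable \<gamma> (\<lambda>z. h (fst z))" "integrable \<gamma> (\<lambda>z. h (snd z))"
    using bound by (auto intro!: \<gamma>.integrable_const_bound[where B=B] AE_I2 simp: space)
  have "(\<integral>x. h x \<partial>\<mu>) = (\<integral>x. h x \<partial>distr \<gamma> \<mu> fst)" "(\<integral>x. h x \<partial>\<nu>) = (\<integral>x. h x \<partial>distr \<gamma> \<nu> snd)"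
    using \<gamma> by (simp_all add: couplings_def)
  then have "(\<integral>x. h x \<partial>\<mu>) - (\<integral>x. h x \<partial>\<nu>) = (\<integral>z. h (fst z) - h (snd z) \<partial>\<gamma>)"
    using int by (simp add: integral_distr)
  then have "\<bar>(\<integral>x. h x \<partial>\<mu>) - (\<integral>x. h x \<partial>\<nu>)\<bar> \<le> (\<integral>z. \<bar>h (fst z) - h (snd z)\<bar> \<partial>\<gamma>)"
    using integral_abs_bound by metis
  also have "\<dots> = k * (\<integral>z. \<bar>h (fst z) - h (snd z)\<bar> / k \<partial>\<gamma>)"
    using \<open>0 < k\<close> by simp
  also have "(\<integral>z. \<bar>h (fst z) - h (snd z)\<bar> / k \<partial>\<gamma>) \<le> \<theta> + e / k"
  proof -
    \<comment> \<open>The division by k stays on the side of h because d need not be measurable.\<close>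
    have "ennreal (\<integral>z. \<bar>h (fst z) - h (snd z)\<bar> / k \<partial>\<gamma>) =
        (\<integral>\<^sup>+ z. ennreal (\<bar>h (fst z) - h (snd z)\<bar> / k) \<partial>\<gamma>)"
      using int \<open>0 < k\<close> by (intro nn_integral_eq_integral[symmetric]) auto
    also have "\<dots> \<le> (\<integral>\<^sup>+ z. ennreal (d (fst z) (snd z)) \<partial>\<gamma>)"
      using Lipschitz \<open>0 < k\<close>
      by (intro nn_integral_mono ennreal_leI) (auto simp: space pos_divide_le_eq mult.commute)
    also have "\<dots> \<le> ennreal (\<theta> + e / k)" using cost by simp
    finally show ?thesis
      using \<open>0 < k\<close> \<open>0 \<le> \<theta>\<close> \<open>0 < e\<close> by (subst (asm) ennreal_le_iff) auto
  qed
  finally show "\<bar>(\<integral>x. h x \<partial>\<mu>) - (\<integral>x. h x \<partial>\<nu>)\<bar> \<le> k * \<theta> + e"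
    using \<open>0 < k\<close> by (simp add: algebra_simps)
qed

section \<open>Lipschitz envelopes for a metric that induces the subspace topology\<close>

locale compatible_metric = Metric_space M d
  for M :: "'a::topological_space set" and d +
  assumes mtopology_eq: "mtopology = top_of_set M"
begin

text \<open>Serves in both directions: a continuous \<open>g\<close> is continuous for
  \<open>d\<close>, which makes its envelopes converge to it, and a function that is Lipschitz for
  \<open>d\<close> is continuous in the subspace topology, hence Borel.\<close>

lemma continuous_on_iff_metric:
  fixes f :: "'a \<Rightarrow> real"
  shows "continuous_on M f \<longleftrightarrow>
    (\<forall>x\<in>M. \<forall>e>0. \<exists>r>0. \<forall>y\<in>M. d x y < r \<longrightarrow> \<bar>f x - f y\<bar> < e)"
proof -
  have "continuous_on M f \<longleftrightarrow> continuous_map mtopology (Metric_space.mtopology UNIV dist) f"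
    by (simp add: mtopology_eq)
  also have "\<dots> \<longleftrightarrow> (\<forall>x\<in>M. \<forall>e>0. \<exists>r>0. \<forall>y\<in>M. d x y < r \<longrightarrow> \<bar>f x - f y\<bar> < e)"
    by (subst metric_continuous_map[OF Met_TC.Metric_space_axioms]) (simp add: dist_real_def Ball_def imp_conjL)
  finally show ?thesis .
qed

text \<open>The Pasch-Hausdorff envelope taken from above: for bounded \<open>g\<close> and
  \<open>0 \<le> k\<close> it is the least majorant of \<open>g\<close> on \<open>M\<close> that is
  \<open>k\<close>-Lipschitz for \<open>d\<close>.\<close>

definition upper_envelope :: "('a \<Rightarrow> real) \<Rightarrow> real \<Rightarrow> 'a \<Rightarrow> real" where
  "upper_envelope g k x = (SUP y\<in>M. g y - k * d x y)"

text \<open>The penalty is nonnegative, so every candidate stays below \<open>B\<close> and the real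
  supremum is meaningful; the candidate \<open>y = x\<close> gives the majorant property, and the
  triangle inequality under the supremum gives the Lipschitz bound.\<close>

lemma upper_envelope:
  assumes g: "\<forall>x\<in>M. \<bar>g x\<bar> \<le> B" and "0 \<le> k" and x: "x \<in> M"
  shows le_upper_envelope: "g x \<le> upper_envelope g k x"
    and upper_envelope_le: "upper_envelope g k x \<le> B"
    and upper_envelope_Lipschitz:
      "y \<in> M \<Longrightarrow> \<bar>upper_envelope g k x - upper_envelope g k y\<bar> \<le> k * d x y"
proof -
  have le: "g z - k * d u z \<le> B" if "z \<in> M" for u z
    using bspec[OF g that] mult_nonneg_nonneg[OF \<open>0 \<le> k\<close> nonneg[of u z]] by linarith
  then have bdd: "bdd_above ((\<lambda>z. g z - k * d u z) ` M)" for u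
    by (intro bdd_aboveI2)
  show "g x \<le> upper_envelope g k x"
    unfolding upper_envelope_def by (rule cSUP_upper2[OF bdd x]) (simp add: x)
  show "upper_envelope g k x \<le> B"
    unfolding upper_envelope_def using x le by (intro cSUP_least) auto
  \<comment> \<open>Each candidate \<open>z\<close> for \<open>u\<close> is also a candidate for
    \<open>v\<close>, at an extra penalty of at most \<open>k * d u v\<close>.\<close>
  have half: "upper_envelope g k u \<le> upper_envelope g k v + k * d u v" if "u \<in> M" "v \<in> M" for u v
    unfolding upper_envelope_def
  proof (rule cSUP_least)
    fix z assume z: "z \<in> M"
    have "k * d v z \<le> k * (d u v + d u z)"
      using triangle[of v u z] that z \<open>0 \<le> k\<close> by (intro mult_left_mono) (auto simp: commute[of v u])
    then have "g z - k * d u z \<le> (g z - k * d v z) + k * d u v"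
      by (simp add: distrib_left)
    also have "g z - k * d v z \<le> (SUP z\<in>M. g z - k * d v z)"
      using z by (rule cSUP_upper) (rule bdd)
    finally show "g z - k * d u z \<le> (SUP z\<in>M. g z - k * d v z) + k * d u v" by simp
  qed (use that in auto)
  show "\<bar>upper_envelope g k x - upper_envelope g k y\<bar> \<le> k * d x y" if "y \<in> M"
    using half[OF x that] half[OF that x] unfolding commute[of y x] by linarith
qed

text \<open>By continuity, candidates near \<open>x\<close> hardly exceed \<open>g x\<close>; for
  large \<open>k\<close> the others pay a penalty above \<open>2 * B\<close>, which bounds the
  oscillation of \<open>g\<close>.\<close>

lemma upper_envelope_tendsto:
  fixes g :: "'a \<Rightarrow> real"
  assumes g: "\<forall>x\<in>M. \<bar>g x\<bar> \<le> B" and cont: "continuous_on M g" and x: "x \<in> M"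
  shows "(\<lambda>k::nat. upper_envelope g (real k) x) \<longlonglongrightarrow> g x"
proof (rule LIMSEQ_I)
  fix e :: real assume "0 < e"
  then have "0 < e / 2" by simp
  then obtain r where r: "0 < r" "\<And>y. y \<in> M \<Longrightarrow> d x y < r \<Longrightarrow> \<bar>g x - g y\<bar> < e / 2"
    using cont x unfolding continuous_on_iff_metric by meson
  obtain K :: nat where K: "2 * B / r < K" using reals_Archimedean2 by blast
  have "norm (upper_envelope g (real k) x - g x) < e" if "K \<le> k" for k
  proof -
    have "g y - real k * d x y \<le> g x + e / 2" if y: "y \<in> M" for y
    proof (cases "d x y < r")
      case True
      have "0 \<le> real k * d x y" by simp
      then show ?thesis using r(2)[OF y True] by linarith
    next
      case False
      have "2 * B < real K * r" using K r(1) by (simp add: pos_divide_less_eq)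
      also have "\<dots> \<le> real k * d x y"
        using False \<open>K \<le> k\<close> r(1) by (intro mult_mono) auto
      finally show ?thesis using bspec[OF g x] bspec[OF g y] \<open>0 < e\<close> by linarith
    qed
    then have "upper_envelope g (real k) x \<le> g x + e / 2"
      unfolding upper_envelope_def using x by (intro cSUP_least) auto
    moreover have "g x \<le> upper_envelope g (real k) x"
      using le_upper_envelope[OF g _ x] by simp
    ultimately show ?thesis using \<open>0 < e\<close> by simp
  qed
  then show "\<exists>K. \<forall>k\<ge>K. norm (upper_envelope g (real k) x - g x) < e" by blast
qed

text \<open>The envelopes are Borel, bounded by \<open>B\<close> and converge pointwise to
  \<open>g\<close>, so dominated convergence makes one of them the required
  \<open>h\<close>.\<close>

lemma Lipschitz_majorant:
  fixes g :: "'a \<Rightarrow> real"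
  assumes g: "\<forall>x\<in>M. \<bar>g x\<bar> \<le> B" and cont: "continuous_on M g"
    and "prob_space P" and sets_P: "sets P = sets (borel_on M)" and "0 < \<eta>"
  obtains h k where "0 < k" "h \<in> borel_measurable (borel_on M)"
    "\<And>x. x \<in> M \<Longrightarrow> g x \<le> h x" "\<And>x. x \<in> M \<Longrightarrow> \<bar>h x\<bar> \<le> B"
    "\<And>x y. x \<in> M \<Longrightarrow> y \<in> M \<Longrightarrow> \<bar>h x - h y\<bar> \<le> k * d x y"
    "(\<integral>x. h x \<partial>P) < (\<integral>x. g x \<partial>P) + \<eta>"
proof -
  interpret P: prob_space P by fact
  have space_P: "space P = M"
    using sets_eq_imp_space_eq[OF sets_P] by (simp add: space_restrict_space)
  let ?h = "\<lambda>k. upper_envelope g (real k)"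
  have abs_h: "\<bar>?h k x\<bar> \<le> B" if "x \<in> M" for k x
    using upper_envelope_le[OF g _ that, where k="real k"] le_upper_envelope[OF g _ that, where k="real k"]
      bspec[OF g that] by simp
  have "continuous_on M (?h k)" for k
    unfolding continuous_on_iff_metric
  proof (intro ballI allI impI)
    fix x and e :: real assume x: "x \<in> M" and "0 < e"
    \<comment> \<open>The \<open>+ 1\<close> in the radius covers \<open>k = 0\<close>.\<close>
    have "\<bar>?h k x - ?h k y\<bar> < e" if "y \<in> M" "d x y < e / (real k + 1)" for y
    proof -
      have "(real k + 1) * d x y < e"
        using that(2) by (simp add: pos_less_divide_eq mult.commute)
      then have "real k * d x y < e"
        unfolding distrib_right using nonneg[of x y] by linarith
      then show ?thesis
        using upper_envelope_Lipschitz[OF g _ x that(1), where k="real k"] by simp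
    qed
    then show "\<exists>r>0. \<forall>y\<in>M. d x y < r \<longrightarrow> \<bar>?h k x - ?h k y\<bar> < e"
      using \<open>0 < e\<close> by (intro exI[of _ "e / (real k + 1)"]) auto
  qed
  then have meas: "?h k \<in> borel_measurable (borel_on M)" for k
    by (rule borel_measurable_continuous_on_restrict)
  have measP: "?h k \<in> borel_measurable P" for k
    using meas measurable_cong_sets[OF sets_P refl] by blast
  have gmeas: "g \<in> borel_measurable P"
    using borel_measurable_continuous_on_restrict[OF cont] measurable_cong_sets[OF sets_P refl]
    by blast
  have "(\<lambda>k. \<integral>x. ?h k x \<partial>P) \<longlonglongrightarrow> (\<integral>x. g x \<partial>P)"
    using abs_h upper_envelope_tendsto[OF g cont]
    by (intro integral_dominated_convergence[where w="\<lambda>_. B"] gmeas measP) (auto simp: space_P)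
  then have "\<forall>\<^sub>F k in sequentially. (\<integral>x. ?h k x \<partial>P) < (\<integral>x. g x \<partial>P) + \<eta>"
    using \<open>0 < \<eta>\<close> by (intro order_tendstoD) auto
  \<comment> \<open>\<open>1 \<le> k\<close> makes the Lipschitz constant positive.\<close>
  then obtain k where k: "1 \<le> k" "(\<integral>x. ?h k x \<partial>P) < (\<integral>x. g x \<partial>P) + \<eta>"
    using eventually_happens'[OF sequentially_bot eventually_conj[OF eventually_ge_at_top[of 1]]]
    by fastforce
  show thesis
    using k abs_h meas le_upper_envelope[OF g, where k="real k"]
      upper_envelope_Lipschitz[OF g, where k="real k"]
    by (intro that[of "real k" "?h k"]) auto
qed

text \<open>The majorant \<open>h\<close> and its constant \<open>k\<close> are fixed before
  \<open>N\<close> and \<open>Q\<close>, which makes the bound uniform over the ball. The chain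
  passes from \<open>g\<close> to \<open>h\<close> under \<open>Q\<close>, through the centre
  \<open>\<nu> N\<close> to \<open>P\<close>, and there from \<open>h\<close> back to
  \<open>g\<close> at a cost of \<open>\<eta> / 2\<close>.\<close>

lemma W1_ball_integral_upper_bound:
  fixes g :: "'a \<Rightarrow> real"
  assumes g: "\<forall>x\<in>M. \<bar>g x\<bar> \<le> B" and cont: "continuous_on M g"
    and P: "prob_space P" "sets P = sets (borel_on M)"
    and \<nu>: "\<And>N. sets (\<nu> N) = sets (borel_on M)"
    and \<epsilon>: "\<forall>\<^sub>F N in sequentially. 0 \<le> \<epsilon> N" "\<epsilon> \<longlonglongrightarrow> 0"
    and W1: "\<forall>\<^sub>F N in sequentially. W1 d P (\<nu> N) \<le> ennreal (\<epsilon> N)"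
    and "0 < \<eta>"
  shows "\<forall>\<^sub>F N in sequentially. \<forall>Q. prob_space Q \<longrightarrow> sets Q = sets (borel_on M) \<longrightarrow>
    W1 d Q (\<nu> N) \<le> ennreal (\<epsilon> N) \<longrightarrow> (\<integral>x. g x \<partial>Q) < (\<integral>x. g x \<partial>P) + \<eta>"
proof -
  have "0 < \<eta> / 2" using \<open>0 < \<eta>\<close> by simp
  from Lipschitz_majorant[OF g cont P this]
  obtain h k where k: "0 < k" and meas: "h \<in> borel_measurable (borel_on M)"
    and gh: "\<And>x. x \<in> M \<Longrightarrow> g x \<le> h x" and h: "\<And>x. x \<in> M \<Longrightarrow> \<bar>h x\<bar> \<le> B"
    and Lip: "\<And>x y. x \<in> M \<Longrightarrow> y \<in> M \<Longrightarrow> \<bar>h x - h y\<bar> \<le> k * d x y"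
    and hP: "(\<integral>x. h x \<partial>P) < (\<integral>x. g x \<partial>P) + \<eta> / 2"
    by metis
  have gmeas: "g \<in> borel_measurable (borel_on M)"
    using cont by (rule borel_measurable_continuous_on_restrict)
  have space: "space Q = M" if "sets Q = sets (borel_on M)" for Q
    using sets_eq_imp_space_eq[OF that] by (simp add: space_restrict_space)
  have measQ: "h \<in> borel_measurable Q" "g \<in> borel_measurable Q"
    if "sets Q = sets (borel_on M)" for Q
    using meas gmeas measurable_cong_sets[OF that refl] by blast+
  \<comment> \<open>The steps from \<open>Q\<close> to the centre and from the centre to
    \<open>P\<close> cost \<open>k * \<epsilon> N\<close> each; together they must stay below the
    other \<open>\<eta> / 2\<close>.\<close>
  have "\<forall>\<^sub>F N in sequentially. \<epsilon> N < \<eta> / (4 * k)"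
    using \<epsilon>(2) \<open>0 < \<eta>\<close> k by (intro order_tendstoD) auto
  with \<epsilon>(1) W1 show ?thesis
  proof eventually_elim
    case (elim N)
    have small: "2 * (k * \<epsilon> N) < \<eta> / 2" using elim(3) k by (simp add: field_simps)
    have step: "\<bar>(\<integral>x. h x \<partial>Q) - (\<integral>x. h x \<partial>\<nu> N)\<bar> \<le> k * \<epsilon> N"
      if "sets Q = sets (borel_on M)" "W1 d Q (\<nu> N) \<le> ennreal (\<epsilon> N)" for Q
      using that h Lip k elim(1)
      by (intro integral_diff_le_W1[where d=d and B=B] measQ) (auto simp: \<nu> space[OF \<nu>] space[OF that(1)])
    show ?case
    proof (intro allI impI)
      fix Q :: "'a measure"
      assume Q: "prob_space Q" "sets Q = sets (borel_on M)" "W1 d Q (\<nu> N) \<le> ennreal (\<epsilon> N)"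
      interpret Q: prob_space Q by fact
      have "(\<integral>x. g x \<partial>Q) \<le> (\<integral>x. h x \<partial>Q)"
        using g h gh measQ[OF Q(2)]
        by (intro integral_mono Q.integrable_const_bound[where B=B]) (auto simp: space[OF Q(2)])
      then show "(\<integral>x. g x \<partial>Q) < (\<integral>x. g x \<partial>P) + \<eta>"
        using step[OF Q(2,3)] step[OF P(2) elim(2)] small hP by linarith
    qed
  qed
qed

end

section \<open>Borel-Cantelli for the samples\<close>

text \<open>Each event depends on the first \<open>N\<close> samples only, so it has the same
  probability under the infinite product as under the \<open>N\<close>-fold one; the complements
  then have summable probabilities.\<close>

lemma AE_eventually_cylinder:
  fixes A :: "nat \<Rightarrow> (nat \<Rightarrow> 'a) \<Rightarrow> bool"
  assumes P: "prob_space P"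
    and cylinder: "\<And>N s. A N (restrict s {..<N}) = A N s"
    and prob: "\<And>N. 1 \<le> N \<Longrightarrow>
      1 - \<beta> N \<le> measure (Pi\<^sub>M {..<N} (\<lambda>_. P)) {s \<in> space (Pi\<^sub>M {..<N} (\<lambda>_. P)). A N s}"
    and \<beta>: "\<And>N. 1 \<le> N \<Longrightarrow> \<beta> N < 1" "summable (\<lambda>N. \<beta> (Suc N))"
  shows "AE s in Pi\<^sub>M UNIV (\<lambda>_. P). \<forall>\<^sub>F N in sequentially. A N s"
proof -
  interpret base: prob_space P by fact
  interpret S: product_prob_space "\<lambda>_::nat. P" UNIV ..
  let ?M = "Pi\<^sub>M UNIV (\<lambda>_::nat. P)"
  \<comment> \<open>The index is shifted because the probability bounds start at sample size 1; the
    shift is undone at the end.\<close>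
  define G where "G N = {s \<in> space ?M. A (Suc N) s}" for N
  have G: "G N \<in> sets ?M" "1 - \<beta> (Suc N) \<le> measure ?M (G N)" for N
  proof -
    let ?S = "{s \<in> space (Pi\<^sub>M {..<Suc N} (\<lambda>_. P)). A (Suc N) s}"
    have pos: "0 < measure (Pi\<^sub>M {..<Suc N} (\<lambda>_. P)) ?S"
      using prob[of "Suc N"] \<beta>(1)[of "Suc N"] by linarith
    \<comment> \<open>Non-measurable sets have measure 0, so the probability bound forces measurability.\<close>
    have S: "?S \<in> sets (Pi\<^sub>M {..<Suc N} (\<lambda>_. P))"
    proof (rule ccontr)
      assume "\<not> ?thesis"
      from measure_notin_sets[OF this] pos show False by simp
    qed
    have emb: "prod_emb UNIV (\<lambda>_. P) {..<Suc N} ?S = G N"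
      using cylinder by (auto simp: prod_emb_def G_def space_PiM PiE_iff)
    show "G N \<in> sets ?M"
      using S unfolding emb[symmetric] by (intro measurable_prod_emb) auto
    have "measure ?M (G N) = measure (Pi\<^sub>M {..<Suc N} (\<lambda>_. P)) ?S"
      using S.emeasure_PiM_emb'[of "{..<Suc N}" ?S] S by (simp add: measure_def emb)
    then show "1 - \<beta> (Suc N) \<le> measure ?M (G N)"
      using prob[of "Suc N"] by simp
  qed
  have "AE s in ?M. \<forall>\<^sub>F N in sequentially. s \<in> space ?M - (space ?M - G N)"
  proof (rule borel_cantelli_AE1)
    show "summable (\<lambda>N. measure ?M (space ?M - G N))"
    proof (rule summable_comparison_test'[OF \<beta>(2)])
      show "norm (measure ?M (space ?M - G N)) \<le> \<beta> (Suc N)" for N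
        using G[of N] by (simp add: S.P.prob_compl)
    qed
  qed (use G in \<open>auto simp: less_top[symmetric]\<close>)
  then show ?thesis
  proof eventually_elim
    case (elim s)
    then have "\<forall>\<^sub>F N in sequentially. A (Suc N) s"
      by eventually_elim (auto simp: G_def)
    then show ?case by (rule eventually_sequentially_Suc[THEN iffD1])
  qed
qed

text \<open>Supplies the cylinder condition for the events in the concentration bound.\<close>

lemma empirical_restrict: "empirical \<Xi> N (restrict s {..<N}) = empirical \<Xi> N s"
  unfolding empirical_def
  by (intro arg_cong2[where f="measure_of \<Xi>"] ext arg_cong2[where f="(*)"] sum.cong) auto

section \<open>Sign criteria for CVaR\<close>

text \<open>Trades an extended-real infimum, attained or not, for real near-minimizers; this is
  where the slack \<open>\<delta>\<close> comes from.\<close>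

lemma INF_ereal_le_0_iff:
  "(INF t::real. ereal (g t)) \<le> 0 \<longleftrightarrow> (\<forall>\<delta>>0. \<exists>t. g t < \<delta>)"
proof
  assume le: "(INF t::real. ereal (g t)) \<le> 0"
  show "\<forall>\<delta>>0. \<exists>t. g t < \<delta>"
  proof (intro allI impI)
    fix \<delta> :: real assume "0 < \<delta>"
    then have "(INF t::real. ereal (g t)) < ereal \<delta>"
      using le by (auto intro: le_less_trans)
    then show "\<exists>t. g t < \<delta>" by (simp add: INF_less_iff)
  qed
next
  assume small: "\<forall>\<delta>>0. \<exists>t. g t < \<delta>"
  show "(INF t::real. ereal (g t)) \<le> 0"
  proof (rule ereal_le_epsilon2)
    fix \<delta> :: real assume "0 < \<delta>"
    then obtain t where "g t < \<delta>" using small by blast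
    then show "(INF t::real. ereal (g t)) \<le> 0 + ereal \<delta>"
      by (intro INF_lower2[of t]) auto
  qed
qed

lemma CVaR_le_0_iff:
  assumes "0 < \<alpha>"
  shows "CVaR P \<alpha> Y \<le> 0 \<longleftrightarrow> (\<forall>\<delta>>0. \<exists>t. (\<integral>\<xi>. max (Y \<xi> + t) 0 \<partial>P) < (t + \<delta>) * \<alpha>)"
proof -
  have "inverse \<alpha> * I - t < \<delta> \<longleftrightarrow> I < (t + \<delta>) * \<alpha>" for I t \<delta>
    using assms by (simp add: field_simps)
  then show ?thesis unfolding CVaR_def INF_ereal_le_0_iff by simp
qed

text \<open>A strict inequality has a witness \<open>t\<close> without slack, and this fixed
  threshold can be carried from \<open>P\<close> to nearby measures.\<close>

lemma CVaR_less_0_iff: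
  assumes "0 < \<alpha>"
  shows "CVaR P \<alpha> Y < 0 \<longleftrightarrow> (\<exists>t. (\<integral>\<xi>. max (Y \<xi> + t) 0 \<partial>P) < t * \<alpha>)"
proof -
  have "inverse \<alpha> * I - t < 0 \<longleftrightarrow> I < t * \<alpha>" for I t
    using assms by (simp add: field_simps)
  then show ?thesis unfolding CVaR_def INF_less_iff by simp
qed

section \<open>Limits of CVaR constraints\<close>

text \<open>Fatou's lemma for Bochner integrals: nonnegativity allows the passage to
  \<open>ennreal\<close>, integrability of the limit the way back.\<close>

lemma Fatou_integral_le:
  fixes f :: "nat \<Rightarrow> 'a \<Rightarrow> real"
  assumes "\<And>n. integrable M (f n)" "\<And>n x. x \<in> space M \<Longrightarrow> 0 \<le> f n x"
    and lim: "\<And>x. x \<in> space M \<Longrightarrow> (\<lambda>n. f n x) \<longlonglongrightarrow> g x"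
    and "integrable M g"
    and le: "\<And>n. (\<integral>x. f n x \<partial>M) \<le> b n" and b: "b \<longlonglongrightarrow> C"
  shows "(\<integral>x. g x \<partial>M) \<le> C"
proof -
  have g0: "0 \<le> g x" if "x \<in> space M" for x
    using LIMSEQ_le_const[OF lim[OF that]] assms(2)[OF that] by blast
  have b0: "0 \<le> b n" for n
    using assms(2) le[of n] by (intro order_trans[OF integral_nonneg_AE le]) auto
  \<comment> \<open>The sign matters since \<open>ennreal\<close> sends negative numbers to
    0.\<close>
  have C0: "0 \<le> C" using LIMSEQ_le_const[OF b] b0 by blast
  have "ennreal (\<integral>x. g x \<partial>M) = (\<integral>\<^sup>+x. ennreal (g x) \<partial>M)"
    using assms(4) g0 by (intro nn_integral_eq_integral[symmetric]) auto
  also have "\<dots> = (\<integral>\<^sup>+x. liminf (\<lambda>n. ennreal (f n x)) \<partial>M)"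
    using lim by (intro nn_integral_cong lim_imp_Liminf[symmetric] tendsto_ennrealI) auto
  also have "\<dots> \<le> liminf (\<lambda>n. \<integral>\<^sup>+x. ennreal (f n x) \<partial>M)"
    using assms(1) by (intro nn_integral_liminf) auto
  also have "\<dots> = liminf (\<lambda>n. ennreal (\<integral>x. f n x \<partial>M))"
    using assms(1,2) by (simp add: nn_integral_eq_integral)
  also have "\<dots> \<le> liminf (\<lambda>n. ennreal (b n))"
    by (intro Liminf_mono always_eventually allI ennreal_leI le)
  also have "\<dots> = ennreal C"
    using b by (intro lim_imp_Liminf tendsto_ennrealI) auto
  finally show ?thesis using C0 by simp
qed

text \<open>Near-optimal thresholds are bounded below because expectations of positive parts are
  nonnegative. Along a subsequence they converge in \<open>ereal\<close>: at a finite limit Fatou's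
  lemma gives the bound, and the limit \<open>\<infinity>\<close> contradicts
  \<open>\<alpha> < 1\<close>.\<close>

lemma CVaR_le_0_limit:
  fixes Y :: "nat \<Rightarrow> 'a \<Rightarrow> real"
  assumes "prob_space P" and \<alpha>: "0 < \<alpha>" "\<alpha> < 1"
    and Y: "\<And>n. integrable P (Y n)" and Z: "integrable P Z"
    and lim: "\<And>\<xi>. \<xi> \<in> space P \<Longrightarrow> (\<lambda>n. Y n \<xi>) \<longlonglongrightarrow> Z \<xi>"
    and le: "\<And>n. CVaR P \<alpha> (Y n) \<le> 0"
  shows "CVaR P \<alpha> Z \<le> 0"
  unfolding CVaR_le_0_iff[OF \<alpha>(1)]
proof (intro allI impI)
  interpret prob_space P by fact
  fix \<delta>' :: real assume "0 < \<delta>'"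
  define \<delta> where "\<delta> = \<delta>' / 2"
  have \<delta>: "0 < \<delta>" "\<delta> < \<delta>'" using \<open>0 < \<delta>'\<close> by (auto simp: \<delta>_def)
  have "\<forall>n. \<exists>t. (\<integral>\<xi>. max (Y n \<xi> + t) 0 \<partial>P) < (t + \<delta>) * \<alpha>"
    using le \<delta>(1) unfolding CVaR_le_0_iff[OF \<alpha>(1)] by blast
  then obtain t where t: "\<And>n. (\<integral>\<xi>. max (Y n \<xi> + t n) 0 \<partial>P) < (t n + \<delta>) * \<alpha>"
    by metis
  have t_ge: "- \<delta> < t n" for n
  proof -
    have "0 \<le> (\<integral>\<xi>. max (Y n \<xi> + t n) 0 \<partial>P)" by simp
    then have "0 < (t n + \<delta>) * \<alpha>" using t[of n] by linarith
    then show ?thesis using \<alpha>(1) by (simp add: zero_less_mult_iff)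
  qed
  obtain l r where r: "strict_mono r" and "((\<lambda>n. ereal (t n)) \<circ> r) \<longlonglongrightarrow> l"
    using compact_complete_linorder by blast
  then have l: "(\<lambda>n. ereal (t (r n))) \<longlonglongrightarrow> l" by (simp add: comp_def)
  have Yr: "(\<lambda>n. Y (r n) \<xi>) \<longlonglongrightarrow> Z \<xi>" if "\<xi> \<in> space P" for \<xi>
    using LIMSEQ_subseq_LIMSEQ[OF lim[OF that] r] by (simp add: comp_def)
  have "ereal (- \<delta>) \<le> l"
    using t_ge by (intro LIMSEQ_le_const[OF l]) (auto intro: less_imp_le)
  then consider (real) u where "l = ereal u" | (infinite) "l = \<infinity>"
    by (cases l) auto
  then show "\<exists>t. (\<integral>\<xi>. max (Z \<xi> + t) 0 \<partial>P) < (t + \<delta>') * \<alpha>"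
  proof cases
    case real
    then have u: "(\<lambda>n. t (r n)) \<longlonglongrightarrow> u" using l by simp
    have "(\<integral>\<xi>. max (Z \<xi> + u) 0 \<partial>P) \<le> (u + \<delta>) * \<alpha>"
    proof (rule Fatou_integral_le)
      show "(\<lambda>n. max (Y (r n) \<xi> + t (r n)) 0) \<longlonglongrightarrow> max (Z \<xi> + u) 0" if "\<xi> \<in> space P" for \<xi>
        by (intro tendsto_intros Yr that u)
      show "(\<lambda>n. (t (r n) + \<delta>) * \<alpha>) \<longlonglongrightarrow> (u + \<delta>) * \<alpha>"
        by (intro tendsto_intros u)
    qed (use Y Z t in \<open>auto intro: less_imp_le\<close>)
    also have "\<dots> < (u + \<delta>') * \<alpha>" using \<delta> \<alpha> by simp
    finally show ?thesis by blast
  next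
    case infinite
    then have top: "filterlim (\<lambda>n. t (r n)) at_top sequentially"
      using l by (simp add: tendsto_PInfty_eq_at_top)
    \<comment> \<open>Dividing by t and passing to the limit would give 1 \<le> \<alpha>.\<close>
    then have inv: "(\<lambda>n. inverse (t (r n))) \<longlonglongrightarrow> 0"
      by (rule tendsto_inverse_0_at_top)
    have "\<forall>\<^sub>F n in sequentially. 0 < t (r n)"
      using top by (rule filterlim_at_top_dense[THEN iffD1, rule_format])
    then obtain n0 where n0: "\<And>n. n0 \<le> n \<Longrightarrow> 0 < t (r n)"
      unfolding eventually_sequentially by blast
    \<comment> \<open>\<open>Fatou_integral_le\<close> asks for its bounds at all indices, so the
      finitely many thresholds that may fail to be positive are dropped.\<close>
    define T where "T n = t (r (n + n0))" for n
    have T: "0 < T n" for n using n0 by (simp add: T_def)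
    have invT: "(\<lambda>n. inverse (T n)) \<longlonglongrightarrow> 0"
      unfolding T_def using inv by (rule LIMSEQ_ignore_initial_segment)
    have YT: "(\<lambda>n. Y (r (n + n0)) \<xi>) \<longlonglongrightarrow> Z \<xi>" if "\<xi> \<in> space P" for \<xi>
      using Yr[OF that] by (rule LIMSEQ_ignore_initial_segment)
    have "(\<integral>\<xi>. 1 \<partial>P) \<le> (1 + \<delta> * 0) * \<alpha>"
    proof (rule Fatou_integral_le)
      show "(\<lambda>n. inverse (T n) * max (Y (r (n + n0)) \<xi> + T n) 0) \<longlonglongrightarrow> 1" if "\<xi> \<in> space P" for \<xi>
      proof -
        have "(\<lambda>n. max (inverse (T n) * Y (r (n + n0)) \<xi> + 1) 0) \<longlonglongrightarrow> max (0 * Z \<xi> + 1) 0"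
          by (intro tendsto_intros YT that invT)
        moreover have "inverse (T n) * max (y + T n) 0 = max (inverse (T n) * y + 1) 0" for n y
          using T[of n] by (simp add: max_mult_distrib_left distrib_left)
        ultimately show ?thesis by simp
      qed
      show "(\<integral>\<xi>. inverse (T n) * max (Y (r (n + n0)) \<xi> + T n) 0 \<partial>P) \<le> (1 + \<delta> * inverse (T n)) * \<alpha>" for n
      proof -
        have "inverse (T n) * (\<integral>\<xi>. max (Y (r (n + n0)) \<xi> + T n) 0 \<partial>P) \<le>
            inverse (T n) * ((T n + \<delta>) * \<alpha>)"
          using t[of "r (n + n0)"] T[of n] by (intro mult_left_mono) (auto simp: T_def)
        also have "\<dots> = (1 + \<delta> * inverse (T n)) * \<alpha>"
          using T[of n] by (simp add: field_simps)
        finally show ?thesis by simp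
      qed
      show "(\<lambda>n. (1 + \<delta> * inverse (T n)) * \<alpha>) \<longlonglongrightarrow> (1 + \<delta> * 0) * \<alpha>"
        by (intro tendsto_intros invT)
    qed (use Y T in \<open>auto simp: less_imp_le\<close>)
    then have False using \<alpha> by (simp add: prob_space)
    then show ?thesis ..
  qed
qed

section \<open>Convexity of the CVaR constraint\<close>

text \<open>The positive part of \<open>Y + t\<close> is jointly convex in \<open>Y\<close> and
  \<open>t\<close>, so the same combination of two thresholds serves for \<open>Y\<close>; the slack
  of \<open>Y\<^sub>1\<close> outweighs the tolerance granted to \<open>Y\<^sub>0\<close>.\<close>

lemma CVaR_convex_combination_less_0:
  fixes Y\<^sub>0 Y\<^sub>1 Y :: "'a \<Rightarrow> real"
  assumes "prob_space P" and \<alpha>: "0 < \<alpha>"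
    and int: "integrable P Y\<^sub>0" "integrable P Y\<^sub>1" "integrable P Y"
    and \<kappa>: "0 < \<kappa>" "\<kappa> \<le> 1"
    and convex: "\<And>\<xi>. \<xi> \<in> space P \<Longrightarrow> Y \<xi> \<le> (1 - \<kappa>) * Y\<^sub>0 \<xi> + \<kappa> * Y\<^sub>1 \<xi>"
    and Y\<^sub>0: "CVaR P \<alpha> Y\<^sub>0 \<le> 0" and Y\<^sub>1: "CVaR P \<alpha> Y\<^sub>1 < 0"
  shows "CVaR P \<alpha> Y < 0"
proof -
  interpret prob_space P by fact
  define E where "E Y t = (\<integral>\<xi>. max (Y \<xi> + t) 0 \<partial>P)" for Y :: "'a \<Rightarrow> real" and t
  obtain t\<^sub>1 where t\<^sub>1: "E Y\<^sub>1 t\<^sub>1 < t\<^sub>1 * \<alpha>"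
    using Y\<^sub>1 unfolding CVaR_less_0_iff[OF \<alpha>] E_def by blast
  \<comment> \<open>\<open>\<delta> * \<alpha>\<close> is the weighted slack of
    \<open>Y\<^sub>1\<close>. The tolerance of \<open>Y\<^sub>0\<close> enters with weight
    \<open>1 - \<kappa>\<close>, so \<open>\<kappa> * (\<delta> * \<alpha>)\<close> is left
    over.\<close>
  define \<delta> where "\<delta> = \<kappa> * (t\<^sub>1 * \<alpha> - E Y\<^sub>1 t\<^sub>1) / \<alpha>"
  have \<delta>_\<alpha>: "\<delta> * \<alpha> = \<kappa> * (t\<^sub>1 * \<alpha> - E Y\<^sub>1 t\<^sub>1)" using \<alpha> by (simp add: \<delta>_def)
  have "0 < \<delta>" using t\<^sub>1 \<kappa> \<alpha> by (simp add: \<delta>_def)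
  then obtain t\<^sub>0 where t\<^sub>0: "E Y\<^sub>0 t\<^sub>0 < (t\<^sub>0 + \<delta>) * \<alpha>"
    using Y\<^sub>0 unfolding CVaR_le_0_iff[OF \<alpha>] E_def by blast
  let ?t = "(1 - \<kappa>) * t\<^sub>0 + \<kappa> * t\<^sub>1"
  have "E Y ?t \<le> (\<integral>\<xi>. (1 - \<kappa>) * max (Y\<^sub>0 \<xi> + t\<^sub>0) 0 + \<kappa> * max (Y\<^sub>1 \<xi> + t\<^sub>1) 0 \<partial>P)"
    unfolding E_def
  proof (rule integral_mono)
    fix \<xi> assume \<xi>: "\<xi> \<in> space P"
    have "Y \<xi> + ?t \<le> (1 - \<kappa>) * (Y\<^sub>0 \<xi> + t\<^sub>0) + \<kappa> * (Y\<^sub>1 \<xi> + t\<^sub>1)"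
      using convex[OF \<xi>] by (simp add: algebra_simps)
    also have "\<dots> \<le> (1 - \<kappa>) * max (Y\<^sub>0 \<xi> + t\<^sub>0) 0 + \<kappa> * max (Y\<^sub>1 \<xi> + t\<^sub>1) 0"
      using \<kappa> by (intro add_mono mult_left_mono) auto
    moreover have "0 \<le> (1 - \<kappa>) * max (Y\<^sub>0 \<xi> + t\<^sub>0) 0 + \<kappa> * max (Y\<^sub>1 \<xi> + t\<^sub>1) 0"
      using \<kappa> by simp
    ultimately show "max (Y \<xi> + ?t) 0 \<le> (1 - \<kappa>) * max (Y\<^sub>0 \<xi> + t\<^sub>0) 0 + \<kappa> * max (Y\<^sub>1 \<xi> + t\<^sub>1) 0"
      by simp
  qed (use int in auto)
  also have "\<dots> = (1 - \<kappa>) * E Y\<^sub>0 t\<^sub>0 + \<kappa> * E Y\<^sub>1 t\<^sub>1"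
    using int by (simp add: E_def)
  also have "\<dots> \<le> (1 - \<kappa>) * ((t\<^sub>0 + \<delta>) * \<alpha>) + \<kappa> * E Y\<^sub>1 t\<^sub>1"
    using t\<^sub>0 \<kappa> by (intro add_right_mono mult_left_mono) auto
  also have "\<dots> = ?t * \<alpha> - \<kappa> * (\<delta> * \<alpha>)"
    by (simp add: \<delta>_\<alpha> distrib_right) (simp add: algebra_simps)
  also have "\<dots> < ?t * \<alpha>"
    using \<alpha> \<kappa> \<open>0 < \<delta>\<close> by simp
  finally show ?thesis unfolding CVaR_less_0_iff[OF \<alpha>] E_def by blast
qed

text \<open>\<open>P\<close> competes in the supremum, and for a probability measure the inner
  objective is \<open>\<alpha>\<close> times that of \<open>CVaR\<close>, so both infima have the
  same sign.\<close>

lemma CVaR_le_0_if_worst_case_risk_le_0: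
  assumes "prob_space P" "integrable P Y" "0 < \<alpha>" "P \<in> \<M>" "worst_case_risk \<M> \<alpha> Y \<le> 0"
  shows "CVaR P \<alpha> Y \<le> 0"
proof -
  interpret prob_space P by fact
  have "(INF t::real. ereal (\<integral>\<xi>. (max (Y \<xi> + t) 0 - t * \<alpha>) \<partial>P)) \<le> 0"
    using assms(4,5) unfolding worst_case_risk_def SUP_le_iff by blast
  moreover have "(\<integral>\<xi>. (max (Y \<xi> + t) 0 - t * \<alpha>) \<partial>P) = (\<integral>\<xi>. max (Y \<xi> + t) 0 \<partial>P) - t * \<alpha>" for t
    using assms(2) by (simp add: prob_space)
  ultimately have *: "\<forall>\<delta>>0. \<exists>t. (\<integral>\<xi>. max (Y \<xi> + t) 0 \<partial>P) - t * \<alpha> < \<delta>"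
    unfolding INF_ereal_le_0_iff by simp
  show ?thesis
    unfolding CVaR_le_0_iff[OF assms(3)]
  proof (intro allI impI)
    fix \<delta> :: real assume "0 < \<delta>"
    then have "0 < \<delta> * \<alpha>" using assms(3) by simp
    with * show "\<exists>t. (\<integral>\<xi>. max (Y \<xi> + t) 0 \<partial>P) < (t + \<delta>) * \<alpha>"
      by (metis add.commute diff_less_eq distrib_right)
  qed
qed

section \<open>Consistency of the distributionally robust programs\<close>

theorem mainTheorem1:
  fixes \<Xi> :: "(real ^ 'm) set"
    and d :: "real ^ 'm \<Rightarrow> real ^ 'm \<Rightarrow> real"
    and X \<Y> :: "(real ^ 'n) set"
    and c :: "real ^ 'n"
    and \<alpha> :: real
    and P :: "(real ^ 'm) measure"
    and F :: "real ^ 'n \<Rightarrow> real ^ 'm \<Rightarrow> real"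
    and \<beta> \<epsilon> :: "nat \<Rightarrow> real"
  assumes d_metric: "Metric_space \<Xi> d"
    and d_complete: "Metric_space.mcomplete \<Xi> d"
    and d_topology: "Metric_space.mtopology \<Xi> d = top_of_set \<Xi>"
    and X: "closed X" "convex X"
    and \<alpha>: "0 < \<alpha>" "\<alpha> < 1"
    and P: "P \<in> P1 \<Xi> d"
    and F_continuous: "continuous_on (UNIV \<times> \<Xi>) (\<lambda>(x, \<xi>). F x \<xi>)"
    and F_convex: "\<And>\<xi>. \<xi> \<in> \<Xi> \<Longrightarrow> convex_on X (\<lambda>x. F x \<xi>)"
    and F_bounded: "\<And>x. x \<in> X \<Longrightarrow> bounded ((\<lambda>\<xi>. F x \<xi>) ` \<Xi>)"
    and F_Lipschitz: "\<exists>L>0. \<forall>x\<in>X. \<forall>\<xi>\<in>\<Xi>. \<forall>\<xi>'\<in>\<Xi>. \<bar>F x \<xi> - F x \<xi>'\<bar> \<le> L * norm (\<xi> - \<xi>')"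
    and \<beta>: "\<And>N. N \<ge> 1 \<Longrightarrow> 0 < \<beta> N \<and> \<beta> N < 1" "summable (\<lambda>N. \<beta> (Suc N))"
    and \<epsilon>: "\<And>N. N \<ge> 1 \<Longrightarrow> 0 < \<epsilon> N" "\<epsilon> \<longlonglongrightarrow> 0"
    and concentration: "\<And>N. N \<ge> 1 \<Longrightarrow>
      measure (Pi\<^sub>M {..<N} (\<lambda>_. P))
        {s \<in> space (Pi\<^sub>M {..<N} (\<lambda>_. P)). W1 d P (empirical \<Xi> N s) \<le> ennreal (\<epsilon> N)} \<ge> 1 - \<beta> N"
    and feasible_interior: "interior (rcp_feasible X P \<alpha> F) \<noteq> {}"
    and strictly_feasible: "\<exists>x\<in>X. CVaR P \<alpha> (F x) < 0"
    and \<Y>: "compact \<Y>" "\<Y> \<subseteq> X"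
    and rcp_optimizers: "optimizers c (rcp_feasible X P \<alpha> F) \<subseteq> \<Y>"
    and drrcp_optimizers: "\<forall>\<^sub>F N in sequentially. \<forall>s. range s \<subseteq> \<Xi> \<longrightarrow>
      optimizers c (drrcp_feasible X (ambiguity_set \<Xi> d (\<epsilon> N) N s) \<alpha> F) \<subseteq> \<Y>"
  shows "AE s in Pi\<^sub>M UNIV (\<lambda>_::nat. P).
      (\<forall>\<^sub>F N in sequentially. optimal_value c (rcp_feasible X P \<alpha> F) \<le>
              optimal_value c (drrcp_feasible X (ambiguity_set \<Xi> d (\<epsilon> N) N s) \<alpha> F)) \<and>
      (\<lambda>N. optimal_value c (drrcp_feasible X (ambiguity_set \<Xi> d (\<epsilon> N) N s) \<alpha> F)) 
            \<longlonglongrightarrow> optimal_value c (rcp_feasible X P \<alpha> F) \<and>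
      (\<forall>x z. (\<forall>\<^sub>F N in sequentially.
              x N \<in> optimizers c (drrcp_feasible X (ambiguity_set \<Xi> d (\<epsilon> N) N s) \<alpha> F)) \<longrightarrow>
            accumulation_point x z \<longrightarrow> z \<in> optimizers c (rcp_feasible X P \<alpha> F))"
proof -
  interpret d: compatible_metric \<Xi> d
    using d_metric d_topology by (intro compatible_metric.intro compatible_metric_axioms.intro)
  have prob_P: "prob_space P" and sets_P: "sets P = sets (borel_on \<Xi>)"
    using P by (auto simp: P1_def)
  have space: "space Q = \<Xi>" if "sets Q = sets (borel_on \<Xi>)" for Q
    using sets_eq_imp_space_eq[OF that] by (simp add: space_restrict_space)
  have F_cont: "continuous_on \<Xi> (F x)" for x
  proof -
    have "continuous_on \<Xi> ((\<lambda>(x, \<xi>). F x \<xi>) \<circ> (\<lambda>\<xi>. (x, \<xi>)))"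
      by (intro continuous_on_compose continuous_intros continuous_on_subset[OF F_continuous]) auto
    then show ?thesis by (simp add: comp_def)
  qed
  have F_bound: "\<exists>B. \<forall>\<xi>\<in>\<Xi>. \<bar>F x \<xi>\<bar> \<le> B" if "x \<in> X" for x
    using F_bounded[OF that] unfolding bounded_iff by auto
  \<comment> \<open>A Bochner integral is 0 by convention when the integrand is not integrable;
    boundedness excludes this for every \<open>Q\<close> at once.\<close>
  have F_int: "integrable Q (F x)" if x: "x \<in> X" and "prob_space Q" and Q: "sets Q = sets (borel_on \<Xi>)" for x Q
  proof -
    interpret Q: prob_space Q by fact
    obtain B where "\<forall>\<xi>\<in>\<Xi>. \<bar>F x \<xi>\<bar> \<le> B" using F_bound[OF x] by blast
    moreover have "F x \<in> borel_measurable Q"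
      using borel_measurable_continuous_on_restrict[OF F_cont] measurable_cong_sets[OF Q refl]
      by blast
    ultimately show ?thesis
      by (intro Q.integrable_const_bound[where B=B]) (auto simp: space[OF Q])
  qed
  let ?R = "rcp_feasible X P \<alpha> F"
  \<comment> \<open>Joint continuity of \<open>F\<close> gives pointwise convergence of
    \<open>F (y k)\<close>, which \<open>CVaR_le_0_limit\<close> needs.\<close>
  have R_closed: "z \<in> ?R" if "\<And>k. y k \<in> ?R" "y \<longlonglongrightarrow> z" for y z
  proof -
    have yX: "y k \<in> X" for k using that(1) by (simp add: rcp_feasible_def)
    have zX: "z \<in> X" using closed_sequentially[OF X(1)] yX that(2) by blast
    have lim: "(\<lambda>k. F (y k) \<xi>) \<longlonglongrightarrow> F z \<xi>" if "\<xi> \<in> space P" for \<xi>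
    proof -
      have "continuous_on UNIV ((\<lambda>(x, \<xi>). F x \<xi>) \<circ> (\<lambda>x. (x, \<xi>)))"
        using that
        by (intro continuous_on_compose continuous_intros continuous_on_subset[OF F_continuous])
          (auto simp: space[OF sets_P])
      then have "isCont (\<lambda>x. F x \<xi>) z" by (simp add: comp_def continuous_on_eq_continuous_at)
      then show ?thesis using \<open>y \<longlonglongrightarrow> z\<close> by (rule isCont_tendsto_compose)
    qed
    have le: "CVaR P \<alpha> (F (y k)) \<le> 0" for k
      using that(1) by (simp add: rcp_feasible_def)
    have "CVaR P \<alpha> (F z) \<le> 0"
      by (rule CVaR_le_0_limit[OF prob_P \<alpha>, of "\<lambda>k. F (y k)"])
        (simp_all add: F_int yX zX prob_P sets_P lim le)
    then show ?thesis using zX by (simp add: rcp_feasible_def)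
  qed
  have "AE s in Pi\<^sub>M UNIV (\<lambda>_::nat. P).
      \<forall>\<^sub>F N in sequentially. W1 d P (empirical \<Xi> N s) \<le> ennreal (\<epsilon> N)"
  proof (rule AE_eventually_cylinder[OF prob_P])
    show "(W1 d P (empirical \<Xi> N (restrict s {..<N})) \<le> ennreal (\<epsilon> N)) =
        (W1 d P (empirical \<Xi> N s) \<le> ennreal (\<epsilon> N))" for N s
      by (simp only: empirical_restrict)
  qed (use concentration \<beta> in blast)+
  \<comment> \<open>From here on the samples are fixed and the argument is deterministic: chance
    enters only through \<open>P\<close> lying in all but finitely many ambiguity sets.\<close>
  then show ?thesis
  proof eventually_elim
    case (elim s)
    let ?M = "\<lambda>N. ambiguity_set \<Xi> d (\<epsilon> N) N s"
    let ?D = "\<lambda>N. drrcp_feasible X (?M N) \<alpha> F"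
    have sub: "\<forall>\<^sub>F N in sequentially. ?D N \<subseteq> ?R"
      using elim
    proof eventually_elim
      case (elim N)
      then have "P \<in> ?M N" using P by (simp add: ambiguity_set_def)
      then show ?case
        using CVaR_le_0_if_worst_case_risk_le_0[OF prob_P F_int[OF _ prob_P sets_P] \<alpha>(1)]
        by (auto simp: drrcp_feasible_def rcp_feasible_def)
    qed
    have strict: "\<forall>\<^sub>F N in sequentially. y \<in> ?D N" if y: "y \<in> X" "CVaR P \<alpha> (F y) < 0" for y
    proof -
      \<comment> \<open>One threshold serves all \<open>Q\<close> in the ball: with the slack of
        \<open>t\<close> as tolerance, the uniform bound below becomes
        \<open>t * \<alpha>\<close>.\<close>
      obtain t where t: "(\<integral>\<xi>. max (F y \<xi> + t) 0 \<partial>P) < t * \<alpha>"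
        using y(2) unfolding CVaR_less_0_iff[OF \<alpha>(1)] by blast
      obtain B where B: "\<And>\<xi>. \<xi> \<in> \<Xi> \<Longrightarrow> \<bar>F y \<xi>\<bar> \<le> B" using F_bound[OF y(1)] by blast
      have "\<forall>\<^sub>F N in sequentially. \<forall>Q. prob_space Q \<longrightarrow> sets Q = sets (borel_on \<Xi>) \<longrightarrow>
          W1 d Q (empirical \<Xi> N s) \<le> ennreal (\<epsilon> N) \<longrightarrow>
          (\<integral>\<xi>. max (F y \<xi> + t) 0 \<partial>Q) <
          (\<integral>\<xi>. max (F y \<xi> + t) 0 \<partial>P) + (t * \<alpha> - (\<integral>\<xi>. max (F y \<xi> + t) 0 \<partial>P))"
      proof (rule d.W1_ball_integral_upper_bound[OF _ _ prob_P sets_P])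
        show "\<forall>\<xi>\<in>\<Xi>. \<bar>max (F y \<xi> + t) 0\<bar> \<le> B + \<bar>t\<bar>"
          using B by fastforce
        show "continuous_on \<Xi> (\<lambda>\<xi>. max (F y \<xi> + t) 0)"
          by (intro continuous_intros F_cont)
        show "\<forall>\<^sub>F N in sequentially. 0 \<le> \<epsilon> N"
          using eventually_ge_at_top[of 1] by eventually_elim (use \<epsilon>(1) in \<open>auto intro: less_imp_le\<close>)
      qed (use \<epsilon>(2) elim t in auto)
      then show ?thesis
      proof eventually_elim
        case (elim N)
        have "(INF u::real. ereal (\<integral>\<xi>. (max (F y \<xi> + u) 0 - u * \<alpha>) \<partial>Q)) \<le> 0" if "Q \<in> ?M N" for Q
        proof -
          have Q: "prob_space Q" "sets Q = sets (borel_on \<Xi>)"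
            and W: "W1 d Q (empirical \<Xi> N s) \<le> ennreal (\<epsilon> N)"
            using that by (auto simp: ambiguity_set_def P1_def)
          interpret Q: prob_space Q by fact
          have "(\<integral>\<xi>. (max (F y \<xi> + t) 0 - t * \<alpha>) \<partial>Q) = (\<integral>\<xi>. max (F y \<xi> + t) 0 \<partial>Q) - t * \<alpha>"
            using F_int[OF y(1) Q] by (simp add: Q.prob_space)
          also have "\<dots> \<le> 0" using elim Q W by fastforce
          finally show ?thesis by (intro INF_lower2[of t]) auto
        qed
        then show ?case using y(1) by (auto simp: drrcp_feasible_def worst_case_risk_def intro: SUP_least)
      qed
    qed
    have le: "\<forall>\<^sub>F N in sequentially. optimal_value c ?R \<le> optimal_value c (?D N)"
      using sub by eventually_elim (auto simp: optimal_value_def intro: INF_superset_mono)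
    \<comment> \<open>Comparison with arbitrary bounds \<open>a\<close> in \<open>ereal\<close> also
      covers a program of value \<open>-\<infinity>\<close>.\<close>
    have lim: "(\<lambda>N. optimal_value c (?D N)) \<longlonglongrightarrow> optimal_value c ?R"
    proof (rule order_tendstoI)
      fix a assume a: "a < optimal_value c ?R"
      from le show "\<forall>\<^sub>F N in sequentially. a < optimal_value c (?D N)"
        by eventually_elim (rule less_le_trans[OF a])
    next
      fix a assume "optimal_value c ?R < a"
      then obtain x where x: "x \<in> ?R" "ereal (c \<bullet> x) < a"
        unfolding optimal_value_def INF_less_iff by blast
      \<comment> \<open>The constraint may be tight at \<open>x\<close>, hence the move towards
        \<open>w\<close>; a small \<open>\<kappa>\<close> keeps the objective below
        \<open>a\<close>.\<close>
      obtain w where w: "w \<in> X" "CVaR P \<alpha> (F w) < 0" using strictly_feasible by blast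
      let ?y = "\<lambda>\<kappa>::real. (1 - \<kappa>) *\<^sub>R x + \<kappa> *\<^sub>R w"
      have "((\<lambda>\<kappa>. ereal (c \<bullet> ?y \<kappa>)) \<longlongrightarrow> ereal (c \<bullet> ((1 - 0) *\<^sub>R x + 0 *\<^sub>R w))) (at_right 0)"
        by (intro tendsto_intros)
      then have "\<forall>\<^sub>F \<kappa> in at_right 0. ereal (c \<bullet> ?y \<kappa>) < a"
        using x(2) by (intro order_tendstoD) auto
      moreover have "\<forall>\<^sub>F \<kappa>::real in at_right 0. \<kappa> \<in> {0<..<1}"
        by (rule eventually_at_right_real) simp
      ultimately have "\<exists>\<kappa>. ereal (c \<bullet> ?y \<kappa>) < a \<and> \<kappa> \<in> {0<..<1}"
        by (intro eventually_happens'[OF trivial_limit_at_right_real] eventually_conj)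
      then obtain \<kappa> where \<kappa>: "0 < \<kappa>" "\<kappa> < 1" and less: "ereal (c \<bullet> ?y \<kappa>) < a" by auto
      have xX: "x \<in> X" using x(1) by (simp add: rcp_feasible_def)
      have yX: "?y \<kappa> \<in> X" using X(2) xX w(1) \<kappa> by (simp add: convex_alt)
      have "CVaR P \<alpha> (F (?y \<kappa>)) < 0"
      proof (rule CVaR_convex_combination_less_0[OF prob_P \<alpha>(1), of "F x" "F w" _ \<kappa>])
        show "F (?y \<kappa>) \<xi> \<le> (1 - \<kappa>) * F x \<xi> + \<kappa> * F w \<xi>" if "\<xi> \<in> space P" for \<xi>
          using convex_onD[OF F_convex, of \<xi> \<kappa> x w] that \<kappa> xX w(1) by (simp add: space[OF sets_P])
      qed (use x(1) w xX yX \<kappa> F_int prob_P sets_P in \<open>auto simp: rcp_feasible_def\<close>)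
      from strict[OF yX this] show "\<forall>\<^sub>F N in sequentially. optimal_value c (?D N) < a"
        by eventually_elim (use less in \<open>auto simp: optimal_value_def INF_less_iff\<close>)
    qed
    have acc: "z \<in> optimizers c ?R"
      if opt: "\<forall>\<^sub>F N in sequentially. x N \<in> optimizers c (?D N)" and acc: "accumulation_point x z" for x z
    proof -
      obtain r where r: "strict_mono r" "(x \<circ> r) \<longlonglongrightarrow> z"
        using acc unfolding accumulation_point_def by blast
      \<comment> \<open>An optimizer attains the optimal value, so the values converge along the
        objective at \<open>x (r k)\<close> and (ii) identifies their limit.\<close>
      have "\<forall>\<^sub>F N in sequentially. x N \<in> ?R \<and> optimal_value c (?D N) = ereal (c \<bullet> x N)"
        using sub opt
        by eventually_elim (auto simp: optimizers_def optimal_value_def intro!: antisym INF_lower INF_greatest)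
      then have ev: "\<forall>\<^sub>F k in sequentially.
          x (r k) \<in> ?R \<and> optimal_value c (?D (r k)) = ereal (c \<bullet> x (r k))"
        using filterlim_subseq[OF r(1)] by (rule eventually_compose_filterlim)
      then obtain K where K: "\<And>k. K \<le> k \<Longrightarrow> x (r k) \<in> ?R" unfolding eventually_sequentially by blast
      have zR: "z \<in> ?R"
        by (rule R_closed[OF _ LIMSEQ_ignore_initial_segment[OF r(2), of K]]) (simp add: K)
      have "(\<lambda>k. ereal (c \<bullet> x (r k))) \<longlonglongrightarrow> ereal (c \<bullet> z)"
        using r(2) unfolding comp_def by (intro tendsto_intros)
      moreover have "(\<lambda>k. ereal (c \<bullet> x (r k))) \<longlonglongrightarrow> optimal_value c ?R"
      proof (rule Lim_transform_eventually)
        show "(\<lambda>k. optimal_value c (?D (r k))) \<longlonglongrightarrow> optimal_value c ?R"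
          using LIMSEQ_subseq_LIMSEQ[OF lim r(1)] by (simp add: comp_def)
        show "\<forall>\<^sub>F k in sequentially. optimal_value c (?D (r k)) = ereal (c \<bullet> x (r k))"
          using ev by eventually_elim simp
      qed
      \<comment> \<open>The objective along the subsequence has two limits, which must agree; hence
        the feasible point \<open>z\<close> attains the value of RCP.\<close>
      ultimately have val: "optimal_value c ?R = ereal (c \<bullet> z)"
        using LIMSEQ_unique by blast
      have "c \<bullet> z \<le> c \<bullet> y" if "y \<in> ?R" for y
      proof -
        have "optimal_value c ?R \<le> ereal (c \<bullet> y)"
          unfolding optimal_value_def using that by (rule INF_lower)
        then show ?thesis by (simp add: val)
      qed
      then show ?thesis using zR by (simp add: optimizers_def)
    qed
    show ?case using le lim acc by blast
  qed
qed

end
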